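(* Let $p\in[0,1]$ and $y:=1-p/2$. The quantities $d_p(n,k)$ and $f_n(p)$ satisfy: (i) $d_p(n,k)=d_p(k,k)\,y^{k(n-k)}$ for $n>k\ge1$; (ii) $\displaystyle d_p(k,k)=1-\sum_{i=1}^{k-1}\binom{k-1}{i-1}d_p(i,i)\,y^{i(k-i)}$ for $k\ge 1$; (iii) $\displaystyle f_n(p)=\sum_{k=1}^{n-1}\binom{n-2}{k-1}d_p(k,k)\,y^{k(n-k)}$ for $n\ge2$.
   Context: $G(n,p)$ is the random graph on the vertex set $[n]=\{1,\dots,n\}$ in which each possible edge is present independently with probability $p$. $\vec G(n,p)$ is obtained from it by giving each present edge one of its two orientations with probability $1/2$ each, independently of everything else. $\{u\not\to v\}$ is the event that there is no directed path from $u$ to $v$. For a vertex $v$, the out-cluster $\overrightarrow{C}_v$ is the random set of all vertices $u$ for which there is a directed path from $v$ to $u$, with the convention $v\in \overrightarrow{C}_v$. For $n\ge1$, a vertex $s$ and a set $X$ with $s\in X\subseteq[n]$ and $|X|=k$, define $d_p(n,k):=\mathbb P_{\vec G(n,p)}(\overrightarrow{C}_s=X)$ (which by symmetry depends only on $n,k,p$); in particular $d_p(1,1)=1$. For distinct vertices $s,b$, define $f_n(p):=\mathbb P_{\vec G(n,p)}(s\not\to b)$. *)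

theory Defs
  imports "HOL-Probability.Probability" "HOL-Combinatorics.Permutations"
begin

definition all_edges :: "nat \<Rightarrow> nat set set" where
  "all_edges n = {e. e \<subseteq> {1..n} \<and> card e = 2}"

definition random_graph :: "real \<Rightarrow> nat \<Rightarrow> nat set set pmf" where
  "random_graph p n =
     map_pmf (\<lambda>b. {e \<in> all_edges n. b e}) (Pi_pmf (all_edges n) False (\<lambda>_. bernoulli_pmf p))"

(* For an edge e = {u, v} the set of its orientations is {(u, v), (v, u)}; the pair (u, v) stands
   for the arc from u to v. *)
definition orientations :: "nat set \<Rightarrow> (nat \<times> nat) set" where
  "orientations e = {(u, v). {u, v} = e}"

(* The value (0, 0) is the default that Pi_pmf assigns outside E; it never enters the image of E. *)
definition random_orientation :: "nat set set \<Rightarrow> (nat \<times> nat) set pmf" where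
  "random_orientation E =
     map_pmf (\<lambda>a. a ` E) (Pi_pmf E (0, 0) (\<lambda>e. pmf_of_set (orientations e)))"

definition random_digraph :: "real \<Rightarrow> nat \<Rightarrow> (nat \<times> nat) set pmf" where
  "random_digraph p n = bind_pmf (random_graph p n) random_orientation"

definition out_cluster :: "(nat \<times> nat) set \<Rightarrow> nat \<Rightarrow> nat set" where
  "out_cluster D v = {u. (v, u) \<in> D\<^sup>*}"

(* d uses s = 1 and X = {1..k}, f uses s = 1 and b = 2; the lemmas prob_out_cluster_eq_d and
   prob_not_reach_eq_f below show that every other admissible choice gives the same value. *)
definition d :: "real \<Rightarrow> nat \<Rightarrow> nat \<Rightarrow> real" where
  "d p n k = measure_pmf.prob (random_digraph p n) {D. out_cluster D 1 = {1..k}}"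

definition f :: "real \<Rightarrow> nat \<Rightarrow> real" where
  "f p n = measure_pmf.prob (random_digraph p n) {D. 2 \<notin> out_cluster D 1}"


lemma finite_all_edges [simp]: "finite (all_edges n)"
  by (rule finite_subset[of _ "Pow {1..n}"]) (auto simp: all_edges_def)

lemma Pi_pmf_reindex:
  fixes h :: "'a \<Rightarrow> 'b" and q :: "'b \<Rightarrow> 'c pmf"
  assumes A: "finite A" and h: "bij h"
  shows "map_pmf (\<lambda>g. g \<circ> h) (Pi_pmf (h ` A) c q) = Pi_pmf A c (q \<circ> h)"
proof (rule pmf_eqI)
  fix g :: "'a \<Rightarrow> 'c"
  have inj: "inj (\<lambda>g :: 'b \<Rightarrow> 'c. g \<circ> h)"
    using h by (metis bij_is_surj fun.inj_map_strong injI surj_fun_eq)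
  have g: "g = (g \<circ> inv h) \<circ> h"
    using h by (auto simp: fun_eq_iff bij_is_inj)
  have "pmf (map_pmf (\<lambda>g. g \<circ> h) (Pi_pmf (h ` A) c q)) g = pmf (Pi_pmf (h ` A) c q) (g \<circ> inv h)"
    by (subst g) (rule pmf_map_inj'[OF inj])
  also have "\<dots> = pmf (Pi_pmf A c (q \<circ> h)) g"
  proof -
    have "(\<forall>x. x \<notin> h ` A \<longrightarrow> (g \<circ> inv h) x = c) \<longleftrightarrow> (\<forall>x. x \<notin> A \<longrightarrow> g x = c)"
      using h by (auto simp: bij_is_inj inj_image_mem_iff) (metis bij_inv_eq_iff imageI inj_image_mem_iff bij_is_inj)+
    moreover have "(\<Prod>x\<in>h ` A. pmf (q x) ((g \<circ> inv h) x)) = (\<Prod>x\<in>A. pmf ((q \<circ> h) x) (g x))"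
      using h by (subst prod.reindex) (auto simp: bij_is_inj inj_on_subset[OF bij_is_inj])
    ultimately show ?thesis using A by (simp only: pmf_Pi finite_imageI)
  qed
  finally show "pmf (map_pmf (\<lambda>g. g \<circ> h) (Pi_pmf (h ` A) c q)) g = pmf (Pi_pmf A c (q \<circ> h)) g" .
qed

lemma bij_image: "bij h \<Longrightarrow> bij ((`) h)"
  by (metis bij_betw_Pow Pow_UNIV)

lemma image_all_edges:
  assumes "\<pi> permutes {1..n}"
  shows "(`) \<pi> ` all_edges n = all_edges n"
proof -
  have sub: "(`) \<sigma> ` all_edges n \<subseteq> all_edges n" if "\<sigma> permutes {1..n}" for \<sigma>
  proof
    fix e' assume "e' \<in> (`) \<sigma> ` all_edges n"
    then obtain e where e: "e' = \<sigma> ` e" "e \<subseteq> {1..n}" "card e = 2" by (auto simp: all_edges_def)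
    have "\<sigma> ` e \<subseteq> {1..n}" using image_mono[OF e(2), of \<sigma>] by (simp only: permutes_image[OF that])
    moreover have "card (\<sigma> ` e) = 2"
      using card_image[OF inj_on_subset[OF permutes_inj[OF that] subset_UNIV], of e] e(3) by simp
    ultimately show "e' \<in> all_edges n" using e(1) by (simp add: all_edges_def)
  qed
  have "all_edges n = (`) \<pi> ` (`) (inv \<pi>) ` all_edges n"
    using permutes_surj[OF assms] by (simp add: image_image surj_f_inv_f image_comp permutes_inv_o[OF assms])
  also have "\<dots> \<subseteq> (`) \<pi> ` all_edges n" by (rule image_mono[OF sub[OF permutes_inv[OF assms]]])
  finally show ?thesis using sub[OF assms] by (rule subset_antisym[rotated])
qed

lemma random_graph_permute:
  assumes "\<pi> permutes {1..n}"
  shows "map_pmf ((`) ((`) \<pi>)) (random_graph p n) = random_graph p n"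
proof -
  let ?P = "Pi_pmf (all_edges n) False (\<lambda>_. bernoulli_pmf p)"
  have bij: "bij ((`) \<pi>)" by (rule bij_image[OF permutes_bij[OF assms]])
  have P: "?P = map_pmf (\<lambda>g. g \<circ> (`) \<pi>) ?P"
    using Pi_pmf_reindex[OF finite_all_edges bij, of n False "\<lambda>_. bernoulli_pmf p"]
    by (simp add: image_all_edges[OF assms] o_def)
  have "map_pmf ((`) ((`) \<pi>)) (random_graph p n) =
      map_pmf ((`) ((`) \<pi>)) (map_pmf (\<lambda>b. {e \<in> all_edges n. b e}) (map_pmf (\<lambda>g. g \<circ> (`) \<pi>) ?P))"
    unfolding random_graph_def by (simp only: P[symmetric])
  also have "\<dots> = map_pmf (\<lambda>b. {e \<in> all_edges n. b e}) ?P"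
    unfolding pmf.map_comp
  proof (rule map_pmf_cong[OF refl], goal_cases)
    case (1 b)
    have "(`) ((`) \<pi>) {e \<in> all_edges n. b (\<pi> ` e)} = {e \<in> (`) \<pi> ` all_edges n. b e}" by auto
    then show ?case by (simp add: image_all_edges[OF assms] o_def)
  qed
  finally show ?thesis by (simp add: random_graph_def)
qed

lemma orientations_edge:
  assumes "card e = 2"
  shows "finite (orientations e)" "orientations e \<noteq> {}"
proof -
  from assms obtain u v where e: "e = {u, v}" by (auto simp: card_2_iff)
  then have "orientations e = {(u, v), (v, u)}"
    by (auto simp: orientations_def doubleton_eq_iff)
  then show "finite (orientations e)" "orientations e \<noteq> {}" by auto
qed

lemma orientations_image:
  assumes "bij \<pi>"
  shows "orientations (\<pi> ` e) = map_prod \<pi> \<pi> ` orientations e"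
proof
  have "inj \<pi>" "surj \<pi>" using assms by (auto simp: bij_def)
  show "orientations (\<pi> ` e) \<subseteq> map_prod \<pi> \<pi> ` orientations e"
  proof
    fix x assume "x \<in> orientations (\<pi> ` e)"
    then obtain u v where x: "x = (\<pi> u, \<pi> v)" "{\<pi> u, \<pi> v} = \<pi> ` e"
      using \<open>surj \<pi>\<close> by (auto simp: orientations_def) (metis surjD)
    then have "\<pi> ` {u, v} = \<pi> ` e" by simp
    then have "{u, v} = e" using \<open>inj \<pi>\<close> by (simp only: inj_image_eq_iff)
    then show "x \<in> map_prod \<pi> \<pi> ` orientations e" using x by (force simp: orientations_def)
  qed
qed (auto simp: orientations_def)

lemma random_orientation_permute:
  assumes \<pi>: "\<pi> permutes {1..n}" and E: "E \<subseteq> all_edges n"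
  shows "random_orientation ((`) \<pi> ` E) = map_pmf ((`) (map_prod \<pi> \<pi>)) (random_orientation E)"
proof -
  let ?h = "(`) \<pi>" and ?m = "map_prod \<pi> \<pi>"
  let ?q = "\<lambda>e. pmf_of_set (orientations e)"
  have bij: "bij \<pi>" by (rule permutes_bij[OF \<pi>])
  have fin: "finite E" by (rule finite_subset[OF E finite_all_edges])
  have inj: "inj ?m" using bij by (simp add: bij_is_inj prod.inj_map)
  have zero: "?m (0, 0) = (0, 0)" using \<pi> by (simp add: permutes_def)
  have q: "(?q \<circ> ?h) e = map_pmf ?m (?q e)" if "e \<in> E" for e
  proof -
    have "card e = 2" using that E by (auto simp: all_edges_def)
    from orientations_edge[OF this] show ?thesis
      by (simp add: map_pmf_of_set_inj inj_on_subset[OF inj] orientations_image[OF bij])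
  qed
  have "random_orientation (?h ` E) =
      map_pmf (\<lambda>a. a ` E) (map_pmf (\<lambda>g. g \<circ> ?h) (Pi_pmf (?h ` E) (0, 0) ?q))"
    by (simp add: random_orientation_def pmf.map_comp o_def image_image)
  also have "\<dots> = map_pmf (\<lambda>a. a ` E) (Pi_pmf E (0, 0) (?q \<circ> ?h))"
    by (simp only: Pi_pmf_reindex[OF fin bij_image[OF bij]])
  also have "Pi_pmf E (0, 0) (?q \<circ> ?h) = Pi_pmf E (0, 0) (\<lambda>e. map_pmf ?m (?q e))"
    by (rule Pi_pmf_cong) (use q in auto)
  also have "\<dots> = map_pmf (\<lambda>a. ?m \<circ> a) (Pi_pmf E (0, 0) ?q)"
    by (rule Pi_pmf_map) (fact fin, fact zero)
  finally show ?thesis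
    by (simp add: random_orientation_def pmf.map_comp o_def image_image)
qed

lemma random_digraph_permute:
  assumes \<pi>: "\<pi> permutes {1..n}"
  shows "map_pmf ((`) (map_prod \<pi> \<pi>)) (random_digraph p n) = random_digraph p n"
proof -
  have sub: "E \<subseteq> all_edges n" if "E \<in> set_pmf (random_graph p n)" for E
    using that by (auto simp: random_graph_def)
  have "map_pmf ((`) (map_prod \<pi> \<pi>)) (random_digraph p n) =
      bind_pmf (random_graph p n) (\<lambda>E. random_orientation ((`) \<pi> ` E))"
    unfolding random_digraph_def map_bind_pmf
    by (rule bind_pmf_cong[OF refl]) (simp add: random_orientation_permute[OF \<pi> sub])
  also have "\<dots> = bind_pmf (map_pmf ((`) ((`) \<pi>)) (random_graph p n)) random_orientation"
    by (simp add: bind_map_pmf)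
  finally show ?thesis by (simp add: random_graph_permute[OF \<pi>] random_digraph_def)
qed

lemma rtrancl_map_prod:
  assumes "(x, y) \<in> D\<^sup>*"
  shows "(\<pi> x, \<pi> y) \<in> (map_prod \<pi> \<pi> ` D)\<^sup>*"
  using assms by induction (auto intro: rtrancl_into_rtrancl)

lemma out_cluster_permute:
  assumes "bij \<pi>"
  shows "out_cluster (map_prod \<pi> \<pi> ` D) (\<pi> v) = \<pi> ` out_cluster D v"
proof -
  have inv: "inv \<pi> (\<pi> x) = x" "\<pi> (inv \<pi> x) = x" for x
    using assms by (auto simp: bij_is_inj bij_is_surj surj_f_inv_f)
  have D: "map_prod (inv \<pi>) (inv \<pi>) ` map_prod \<pi> \<pi> ` D = D"
    by (simp add: image_image map_prod_def case_prod_beta inv)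
  have "u \<in> \<pi> ` out_cluster D v" if "(\<pi> v, u) \<in> (map_prod \<pi> \<pi> ` D)\<^sup>*" for u
    using rtrancl_map_prod[OF that, of "inv \<pi>"] unfolding D inv out_cluster_def
    by (metis (mono_tags) image_eqI inv(2) mem_Collect_eq)
  then show ?thesis by (auto simp: out_cluster_def intro: rtrancl_map_prod)
qed

lemma prob_permute:
  assumes "\<pi> permutes {1..n}"
  shows "measure_pmf.prob (random_digraph p n) {D. P (out_cluster D (\<pi> s))} =
         measure_pmf.prob (random_digraph p n) {D. P (\<pi> ` out_cluster D s)}"
  by (subst random_digraph_permute[OF assms, symmetric])
     (simp add: vimage_def out_cluster_permute[OF permutes_bij[OF assms]])

lemma prob_out_cluster_eq_d:
  assumes "s \<in> X" "X \<subseteq> {1..n}" "card X = k"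
  shows "measure_pmf.prob (random_digraph p n) {D. out_cluster D s = X} = d p n k"
proof -
  have fin: "finite X" using assms(2) finite_subset by blast
  have k: "1 \<le> k" "k \<le> n"
    using assms fin card_mono[OF _ assms(2)] by (auto simp: Suc_le_eq card_gt_0_iff)
  obtain g where g: "bij_betw g ({1..k} - {1}) (X - {s})"
    using finite_same_card_bij[of "{1..k} - {1}" "X - {s}"] assms fin k by auto
  obtain g' where g': "bij_betw g' ({1..n} - {1..k}) ({1..n} - X)"
    using finite_same_card_bij[of "{1..n} - {1..k}" "{1..n} - X"] assms fin k
    by (auto simp: card_Diff_subset)
  define \<pi> where "\<pi> i = (if i = 1 then s else if i \<in> {1..k} then g i
                         else if i \<in> {1..n} then g' i else i)" for i
  have b1: "bij_betw \<pi> {1} {s}" by (simp add: \<pi>_def bij_betw_def)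
  have b2: "bij_betw \<pi> ({1..k} - {1}) (X - {s})"
    by (rule iffD1[OF bij_betw_cong g]) (auto simp: \<pi>_def)
  have b3: "bij_betw \<pi> ({1..n} - {1..k}) ({1..n} - X)"
    by (rule iffD1[OF bij_betw_cong g']) (use k in \<open>auto simp: \<pi>_def\<close>)
  have "bij_betw \<pi> ({1} \<union> ({1..k} - {1})) ({s} \<union> (X - {s}))"
    by (rule bij_betw_combine[OF b1 b2]) auto
  then have bX: "bij_betw \<pi> {1..k} X" using k assms by (simp add: insert_absorb)
  have "bij_betw \<pi> ({1..k} \<union> ({1..n} - {1..k})) (X \<union> ({1..n} - X))"
    by (rule bij_betw_combine[OF bX b3]) auto
  then have "bij_betw \<pi> {1..n} {1..n}"
    using k assms(2) by (simp add: Un_absorb1)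
  then have perm: "\<pi> permutes {1..n}"
    by (rule bij_imp_permutes) (use k in \<open>auto simp: \<pi>_def\<close>)
  have "\<pi> 1 = s" "\<pi> ` {1..k} = X" using bX by (auto simp: \<pi>_def bij_betw_def)
  moreover have "\<pi> ` A = \<pi> ` {1..k} \<longleftrightarrow> A = {1..k}" for A
    by (rule inj_image_eq_iff[OF permutes_inj[OF perm]])
  ultimately show ?thesis
    using prob_permute[OF perm, of p "\<lambda>C. C = X" 1] by (simp add: d_def)
qed

lemma prob_not_reach_eq_f:
  assumes "s \<in> {1..n}" "b \<in> {1..n}" "s \<noteq> b"
  shows "measure_pmf.prob (random_digraph p n) {D. b \<notin> out_cluster D s} = f p n"
proof -
  have n: "2 \<le> n" using assms by auto
  define \<sigma> where "\<sigma> = Transposition.transpose 1 s"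
  have \<sigma>: "\<sigma> permutes {1..n}" unfolding \<sigma>_def by (rule permutes_swap_id) (use assms n in auto)
  have \<sigma>1: "\<sigma> 1 = s" by (simp add: \<sigma>_def)
  have \<sigma>2: "\<sigma> 2 \<in> {1..n}" using permutes_in_image[OF \<sigma>, of 2] n by simp
  have ne: "\<sigma> 2 \<noteq> s" using permutes_inj[OF \<sigma>] \<sigma>1 by (metis injD numeral_One numeral_eq_iff semiring_norm(85))
  define \<pi> where "\<pi> = Transposition.transpose (\<sigma> 2) b \<circ> \<sigma>"
  have perm: "\<pi> permutes {1..n}" unfolding \<pi>_def
    by (rule permutes_compose[OF \<sigma> permutes_swap_id]) (use assms \<sigma>2 in auto)
  have \<pi>: "\<pi> 1 = s" "\<pi> 2 = b" using \<sigma>1 ne assms by (auto simp: \<pi>_def Transposition.transpose_def)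
  have "b \<in> \<pi> ` A \<longleftrightarrow> 2 \<in> A" for A
    using inj_image_mem_iff[OF permutes_inj[OF perm], of 2 A] \<pi> by simp
  then show ?thesis
    using prob_permute[OF perm, of p "\<lambda>C. b \<notin> C" 1] \<pi> by (simp add: f_def)
qed

end

theory Submission
  imports Defs
begin

text \<open>
  The out-cluster of \<open>s\<close> is \<open>X\<close> exactly when the arcs inside \<open>X\<close> already carry \<open>s\<close> to every
  vertex of \<open>X\<close> and no arc leaves \<open>X\<close> (\<open>out_cluster_eq_iff\<close>). The first condition depends only on
  the edges inside \<open>X\<close>, the second only on the edges with an end outside \<open>X\<close>, so the two events
  are independent. Inside \<open>X\<close> one sees a copy of the random digraph on \<open>k = card X\<close> vertices, which
  contributes \<open>d p k k\<close>. Each of the \<open>k * (n - k)\<close> edges between \<open>X\<close> and its complement yields an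
  arc leaving \<open>X\<close> with probability \<open>p / 2\<close>, so all of them avoid this with probability
  \<open>(1 - p / 2) ^ (k * (n - k))\<close>. The product of the two is the first identity (\<open>d_eq_d_diag\<close>).

  The other two identities sum it over the possible clusters of a vertex \<open>s\<close>. For a vertex set
  \<open>V\<close> containing \<open>s\<close>, there are \<open>(card V - 1) choose (k - 1)\<close> candidates of size \<open>k\<close> inside \<open>V\<close>, all
  equally likely (\<open>prob_out_cluster_subset\<close>). With \<open>V\<close> the whole vertex set the total is 1, and
  isolating the term of the full cluster gives the recursion for \<open>d p k k\<close>. With \<open>V\<close> the vertex set
  without \<open>b\<close> the total is the probability that \<open>b\<close> is not reached.
\<close>

section \<open>The random digraph as a product measure\<close>

text \<open>
  Deleting and orienting an edge are merged into one random choice per edge, whose value is the set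
  of arcs that the edge contributes: empty, or a singleton. Thereby both stages of the random
  digraph become a single product measure over the edges, and events that concern disjoint sets of
  edges are visibly independent.
\<close>

definition edge_arcs_pmf :: "real \<Rightarrow> nat set \<Rightarrow> (nat \<times> nat) set pmf" where
  "edge_arcs_pmf p e = bind_pmf (bernoulli_pmf p)
     (\<lambda>b. if b then map_pmf (\<lambda>a. {a}) (pmf_of_set (orientations e)) else return_pmf {})"

text \<open>
  The default value changes from the arc \<open>(0, 0)\<close> to the empty set, so that an edge outside \<open>E\<close>
  takes the same value as an edge that is absent from the random graph.
\<close>

lemma random_orientation_eq_product:
  assumes "finite E"
  shows "random_orientation E = map_pmf (\<lambda>g. \<Union>e\<in>E. g e)
           (Pi_pmf E {} (\<lambda>e. map_pmf (\<lambda>a. {a}) (pmf_of_set (orientations e))))"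
proof -
  let ?q = "\<lambda>e. pmf_of_set (orientations e)"
  have "Pi_pmf E {} (\<lambda>e. map_pmf (\<lambda>a. {a}) (?q e)) =
      map_pmf (\<lambda>g e. if e \<in> E then g e else {})
        (Pi_pmf E {(0, 0)} (\<lambda>e. map_pmf (\<lambda>a. {a}) (?q e)))"
    by (rule Pi_pmf_default_swap[OF assms, symmetric])
  also have "Pi_pmf E {(0, 0)} (\<lambda>e. map_pmf (\<lambda>a. {a}) (?q e)) =
      map_pmf (\<lambda>a. (\<lambda>x. {x}) \<circ> a) (Pi_pmf E (0, 0) ?q)"
    by (rule Pi_pmf_map[OF assms refl])
  finally show ?thesis
    by (auto simp: random_orientation_def pmf.map_comp o_def intro!: map_pmf_cong)
qed

text \<open>
  Drawing all the coins of the random graph and then all orientations is the same as doing both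
  edge by edge, because the orientation of an edge depends on its own coin only.
\<close>

lemma random_digraph_eq_product:
  "random_digraph p n =
     map_pmf (\<lambda>g. \<Union>e\<in>all_edges n. g e) (Pi_pmf (all_edges n) {} (edge_arcs_pmf p))"
proof -
  let ?A = "all_edges n"
  let ?o = "\<lambda>e. map_pmf (\<lambda>a. {a}) (pmf_of_set (orientations e))"
  have present: "random_orientation {e \<in> ?A. b e} =
      map_pmf (\<lambda>g. \<Union>e\<in>?A. g e) (Pi_pmf ?A {} (\<lambda>e. if b e then ?o e else return_pmf {}))" for b
  proof -
    have "(\<Union>e\<in>{e \<in> ?A. b e}. g e) = (\<Union>e\<in>?A. g e)"
      if "g \<in> set_pmf (Pi_pmf {e \<in> ?A. b e} {} ?o)" for g
      using that set_Pi_pmf_subset[of "{e \<in> ?A. b e}" "{}" ?o] by fastforce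
    then show ?thesis
      by (simp add: random_orientation_eq_product Pi_pmf_if_set cong: map_pmf_cong)
  qed
  have "Pi_pmf ?A {} (edge_arcs_pmf p) =
      bind_pmf (Pi_pmf ?A False (\<lambda>_. bernoulli_pmf p))
        (\<lambda>b. Pi_pmf ?A {} (\<lambda>e. if b e then ?o e else return_pmf {}))"
    unfolding edge_arcs_pmf_def by (rule Pi_pmf_bind) simp
  then show ?thesis
    by (simp add: random_digraph_def random_graph_def bind_map_pmf map_bind_pmf present)
qed

lemma set_edge_arcs_pmf:
  assumes "card e = 2" "A \<in> set_pmf (edge_arcs_pmf p e)"
  shows "A \<subseteq> orientations e"
  using assms(2) orientations_edge[OF assms(1)]
  by (auto simp: edge_arcs_pmf_def split: if_splits)

lemma set_Pi_edge_arcs: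
  assumes "finite E" "E \<subseteq> all_edges n" "g \<in> set_pmf (Pi_pmf E {} (edge_arcs_pmf p))" "e \<in> E"
  shows "g e \<subseteq> orientations e"
proof (rule set_edge_arcs_pmf)
  show "card e = 2" using assms by (auto simp: all_edges_def)
  show "g e \<in> set_pmf (edge_arcs_pmf p e)"
    using assms by (auto simp: set_Pi_pmf PiE_dflt_def)
qed

text \<open>
  The truth values of the two predicates form a pair of independent Booleans; evaluating their joint
  mass at \<open>(True, True)\<close> avoids any countability condition on the underlying types.
\<close>

lemma prob_pair_pmf:
  "measure_pmf.prob (pair_pmf M N) {(a, b). P a \<and> Q b} =
     measure_pmf.prob M {a. P a} * measure_pmf.prob N {b. Q b}"
proof -
  have "pmf (pair_pmf (map_pmf P M) (map_pmf Q N)) (True, True) =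
      measure_pmf.prob M {a. P a} * measure_pmf.prob N {b. Q b}"
    by (simp add: pmf_pair pmf_map vimage_def)
  moreover have "pmf (map_pmf (map_prod P Q) (pair_pmf M N)) (True, True) =
      measure_pmf.prob (pair_pmf M N) {(a, b). P a \<and> Q b}"
    by (simp add: pmf_map vimage_def case_prod_beta' map_prod_def prod_eq_iff)
  ultimately show ?thesis by (simp add: map_prod_def map_pair)
qed

section \<open>Arcs leaving a vertex set\<close>

text \<open>
  A path that starts in a set which no arc leaves stays in it, and hence uses only arcs inside it.
  The two conditions on the right concern disjoint sets of potential arcs, which makes the
  characterisation useful for independence.
\<close>

lemma out_cluster_eq_iff:
  assumes "s \<in> X"
  shows "out_cluster D s = X \<longleftrightarrow>
           out_cluster (D \<inter> X \<times> X) s = X \<and> D \<inter> X \<times> (- X) = {}"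
proof
  assume C: "out_cluster D s = X"
  have closed: "D \<inter> X \<times> (- X) = {}"
    using C by (auto simp: out_cluster_def intro: rtrancl_into_rtrancl)
  have "(s, u) \<in> (D \<inter> X \<times> X)\<^sup>*" if "(s, u) \<in> D\<^sup>*" for u
    using that
  proof induction
    case (step v w)
    then have "v \<in> X" "w \<in> X"
      using C by (auto simp: out_cluster_def intro: rtrancl_into_rtrancl)
    with step show ?case by (auto intro: rtrancl_into_rtrancl)
  qed simp
  moreover have "(D \<inter> X \<times> X)\<^sup>* \<subseteq> D\<^sup>*" by (rule rtrancl_mono) auto
  ultimately show "out_cluster (D \<inter> X \<times> X) s = X \<and> D \<inter> X \<times> (- X) = {}"
    using C closed by (auto simp: out_cluster_def)
next
  assume C: "out_cluster (D \<inter> X \<times> X) s = X \<and> D \<inter> X \<times> (- X) = {}"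
  have "u \<in> X" if "(s, u) \<in> D\<^sup>*" for u
    using that by induction (use assms C in auto)
  moreover have "(D \<inter> X \<times> X)\<^sup>* \<subseteq> D\<^sup>*" by (rule rtrancl_mono) auto
  ultimately show "out_cluster D s = X"
    using C by (auto simp: out_cluster_def)
qed

text \<open>
  An edge with exactly one end in \<open>X\<close> gives an arc out of \<open>X\<close> only if it is present and gets the
  outward one of its two orientations.
\<close>

lemma prob_edge_no_arc_leaving:
  assumes p: "p \<in> {0..1}" and e: "card e = 2" "\<not> e \<subseteq> X"
  shows "measure_pmf.prob (edge_arcs_pmf p e) {A. A \<inter> X \<times> (- X) = {}} =
           (if e \<inter> X = {} then 1 else 1 - p / 2)"
proof (cases "e \<inter> X = {}")
  case True
  have "A \<inter> X \<times> (- X) = {}" if "A \<in> set_pmf (edge_arcs_pmf p e)" for A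
    using set_edge_arcs_pmf[OF e(1) that] True by (auto simp: orientations_def)
  then show ?thesis
    using True by (simp add: measure_pmf.prob_eq_1 AE_measure_pmf_iff)
next
  case False
  then obtain u v where uv: "e = {u, v}" "u \<in> X" "v \<notin> X" "u \<noteq> v"
    using e by (auto simp: card_2_iff)
  then have o: "orientations e = {(u, v), (v, u)}"
    by (auto simp: orientations_def doubleton_eq_iff)
  let ?Q = "\<lambda>A. A \<inter> X \<times> (- X) = {}"
  let ?o = "map_pmf (\<lambda>a. {a}) (pmf_of_set (orientations e))"
  have "pmf (map_pmf ?Q ?o) True = card {(v, u)} / card {(u, v), (v, u)}"
    unfolding o using uv by (simp add: pmf_map measure_pmf_of_set vimage_def)
  also have "\<dots> = 1 / 2" using uv by simp
  finally have half: "pmf (map_pmf ?Q ?o) True = 1 / 2" .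
  have "measure_pmf.prob (edge_arcs_pmf p e) {A. ?Q A} = pmf (map_pmf ?Q (edge_arcs_pmf p e)) True"
    by (simp add: pmf_map vimage_def)
  also have "\<dots> = p * pmf (map_pmf ?Q ?o) True + (1 - p) * pmf (map_pmf ?Q (return_pmf {})) True"
    unfolding edge_arcs_pmf_def map_bind_pmf pmf_bind
    using p by (subst integral_bernoulli_pmf) auto
  also have "\<dots> = p * (1 / 2) + (1 - p)"
    by (simp only: half) simp
  finally have "measure_pmf.prob (edge_arcs_pmf p e) {A. ?Q A} = p * (1 / 2) + (1 - p)" .
  then show ?thesis using False by (simp add: field_simps)
qed

lemma card_crossing_edges:
  assumes "k \<le> n"
  shows "card {e \<in> all_edges n - all_edges k. e \<inter> {1..k} \<noteq> {}} = k * (n - k)"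
proof -
  have "{e \<in> all_edges n - all_edges k. e \<inter> {1..k} \<noteq> {}} =
      (\<lambda>(u, v). {u, v}) ` ({1..k} \<times> {k + 1..n})"
  proof (intro equalityI subsetI)
    fix e assume e: "e \<in> {e \<in> all_edges n - all_edges k. e \<inter> {1..k} \<noteq> {}}"
    have card: "card e = 2" and sub: "e \<subseteq> {1..n}" "\<not> e \<subseteq> {1..k}"
      using e by (auto simp: all_edges_def)
    from e obtain u where u: "u \<in> e" "u \<in> {1..k}" by blast
    from sub obtain v where v: "v \<in> e" "v \<in> {k + 1..n}"
      by (metis atLeastAtMost_iff not_less_eq_eq Suc_eq_plus1 subset_iff)
    have "u \<noteq> v" using u v by auto
    with card u v have "e = {u, v}" by (metis card_2_iff doubleton_eq_iff insertE singletonD)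
    with u v show "e \<in> (\<lambda>(u, v). {u, v}) ` ({1..k} \<times> {k + 1..n})" by force
  next
    fix e assume "e \<in> (\<lambda>(u, v). {u, v}) ` ({1..k} \<times> {k + 1..n})"
    then obtain u v where "e = {u, v}" "u \<in> {1..k}" "v \<in> {k + 1..n}" by auto
    then show "e \<in> {e \<in> all_edges n - all_edges k. e \<inter> {1..k} \<noteq> {}}"
      using assms by (auto simp: all_edges_def)
  qed
  moreover have "inj_on (\<lambda>(u, v). {u, v}) ({1..k} \<times> {k + 1..n})"
    by (rule inj_onI) (auto simp: doubleton_eq_iff)
  ultimately show ?thesis by (simp add: card_image card_cartesian_product)
qed

text \<open>
  The edge set splits into the edges within \<open>{1..k}\<close>, which are literally those of the random
  digraph on \<open>k\<close> vertices, and the rest; the product measure splits accordingly. The rest also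
  contains edges disjoint from \<open>{1..k}\<close>, which never give an arc leaving it and contribute factors 1.
\<close>

lemma d_eq_d_diag:
  assumes p: "p \<in> {0..1}" and k: "1 \<le> k" "k \<le> n"
  shows "d p n k = d p k k * (1 - p / 2) ^ (k * (n - k))"
proof -
  let ?A = "all_edges k" and ?B = "all_edges n - all_edges k"
  let ?X = "{1..k}" and ?U = "\<lambda>E g. \<Union>e\<in>E. g e"
  let ?P = "\<lambda>E. Pi_pmf E {} (edge_arcs_pmf p)"
  let ?inner = "\<lambda>g. out_cluster (?U ?A g) 1 = ?X"
  let ?outer = "\<lambda>g. \<forall>e\<in>?B. g e \<inter> ?X \<times> (- ?X) = {}"
  have AB: "all_edges n = ?A \<union> ?B" using k by (auto simp: all_edges_def)
  have card2: "card e = 2" "\<not> e \<subseteq> ?X" if "e \<in> ?B" for e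
    using that by (auto simp: all_edges_def)
  have "d p n k = measure_pmf.prob (?P (?A \<union> ?B)) {g. out_cluster (?U (?A \<union> ?B) g) 1 = ?X}"
    unfolding d_def random_digraph_eq_product using AB by (simp add: vimage_def)
  also have "\<dots> = measure_pmf.prob (pair_pmf (?P ?A) (?P ?B)) {(f, g). out_cluster
      (?U (?A \<union> ?B) (\<lambda>e. if e \<in> ?A then f e else g e)) 1 = ?X}"
    unfolding Pi_pmf_union[OF finite_all_edges finite_Diff[OF finite_all_edges] Diff_disjoint]
    by (simp only: measure_map_pmf vimage_def mem_Collect_eq case_prod_beta')
  \<comment> \<open>The events agree only almost surely: an edge contributes none but its own orientations.\<close>
  also have "\<dots> = measure_pmf.prob (pair_pmf (?P ?A) (?P ?B)) {(f, g). ?inner f \<and> ?outer g}"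
  proof (rule measure_pmf.finite_measure_eq_AE)
    show "AE x in measure_pmf (pair_pmf (?P ?A) (?P ?B)).
        (x \<in> {(f, g). out_cluster (?U (?A \<union> ?B) (\<lambda>e. if e \<in> ?A then f e else g e)) 1 = ?X})
        = (x \<in> {(f, g). ?inner f \<and> ?outer g})"
    proof (simp only: AE_measure_pmf_iff, rule ballI, clarsimp simp del: UN_simps, goal_cases)
      case (1 f g)
      have f: "f e \<subseteq> ?X \<times> ?X" if "e \<in> ?A" for e
        using set_Pi_edge_arcs[OF finite_all_edges order_refl 1(1) that] that
        by (auto simp: orientations_def all_edges_def)
      have g: "g e \<inter> ?X \<times> ?X = {}" if "e \<in> ?B" for e
        using set_Pi_edge_arcs[OF _ _ 1(2) that, of n] card2(2)[OF that]
        by (fastforce simp: orientations_def)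
      let ?D = "?U (?A \<union> ?B) (\<lambda>e. if e \<in> ?A then f e else g e)"
      have D: "?D = ?U ?A f \<union> ?U ?B g" by auto
      have "?D \<inter> ?X \<times> ?X = ?U ?A f" unfolding D using f g by blast
      moreover have "?D \<inter> ?X \<times> (- ?X) = {} \<longleftrightarrow> ?outer g" unfolding D using f by blast
      ultimately show ?case using out_cluster_eq_iff[of 1 ?X ?D] k by simp
    qed
  qed simp_all
  also have "\<dots> = measure_pmf.prob (?P ?A) {f. ?inner f} * measure_pmf.prob (?P ?B) {g. ?outer g}"
    by (rule prob_pair_pmf)
  also have "measure_pmf.prob (?P ?A) {f. ?inner f} = d p k k"
    unfolding d_def random_digraph_eq_product by (simp add: vimage_def)
  also have "measure_pmf.prob (?P ?B) {g. ?outer g} = (1 - p / 2) ^ (k * (n - k))"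
  proof -
    have "{g. ?outer g} = Pi ?B (\<lambda>_. {A. A \<inter> ?X \<times> (- ?X) = {}})"
      unfolding Pi_def by blast
    then have "measure_pmf.prob (?P ?B) {g. ?outer g} =
        (\<Prod>e\<in>?B. measure_pmf.prob (edge_arcs_pmf p e) {A. A \<inter> ?X \<times> (- ?X) = {}})"
      by (simp only: measure_Pi_pmf_Pi[OF finite_Diff[OF finite_all_edges]])
    also have "\<dots> = (\<Prod>e\<in>?B. if e \<inter> ?X \<noteq> {} then 1 - p / 2 else 1)"
      by (rule prod.cong[OF refl])
         (simp only: prob_edge_no_arc_leaving[OF p card2] split: if_split, simp)
    also have "\<dots> = (\<Prod>e\<in>{e \<in> ?B. e \<inter> ?X \<noteq> {}}. 1 - p / 2)"
      by (rule prod.inter_filter[symmetric]) simp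
    also have "\<dots> = (1 - p / 2) ^ card {e \<in> ?B. e \<inter> ?X \<noteq> {}}"
      by (rule prod_constant)
    finally show ?thesis by (simp only: card_crossing_edges[OF k(2)])
  qed
  finally show ?thesis .
qed

section \<open>Summing over the possible clusters\<close>

lemma out_cluster_random_digraph_subset:
  assumes "D \<in> set_pmf (random_digraph p n)" "s \<in> {1..n}"
  shows "out_cluster D s \<subseteq> {1..n}"
proof
  fix u assume "u \<in> out_cluster D s"
  have "D \<subseteq> {1..n} \<times> {1..n}"
  proof -
    obtain g where g: "g \<in> set_pmf (Pi_pmf (all_edges n) {} (edge_arcs_pmf p))"
      and D: "D = (\<Union>e\<in>all_edges n. g e)"
      using assms(1) by (auto simp: random_digraph_eq_product)
    have "g e \<subseteq> {1..n} \<times> {1..n}" if "e \<in> all_edges n" for e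
      using set_Pi_edge_arcs[OF finite_all_edges order_refl g that] that
      by (auto simp: orientations_def all_edges_def)
    then show ?thesis unfolding D by (rule UN_least)
  qed
  moreover have "(s, u) \<in> D\<^sup>*" using \<open>u \<in> out_cluster D s\<close> by (simp add: out_cluster_def)
  then have "u = s \<or> (\<exists>v. (v, u) \<in> D)" by (metis rtranclE)
  ultimately show "u \<in> {1..n}" using assms(2) by auto
qed

lemma card_subsets_containing:
  assumes "finite V" "s \<in> V"
  shows "card {X. s \<in> X \<and> X \<subseteq> V \<and> card X = Suc j} = (card V - 1) choose j"
proof -
  have fin: "finite X" if "X \<subseteq> V" for X using assms that finite_subset by blast
  have "{X. s \<in> X \<and> X \<subseteq> V \<and> card X = Suc j} = insert s ` {Y. Y \<subseteq> V - {s} \<and> card Y = j}"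
  proof (intro equalityI subsetI)
    fix X assume X: "X \<in> {X. s \<in> X \<and> X \<subseteq> V \<and> card X = Suc j}"
    then have "X = insert s (X - {s})" "X - {s} \<in> {Y. Y \<subseteq> V - {s} \<and> card Y = j}" by auto
    then show "X \<in> insert s ` {Y. Y \<subseteq> V - {s} \<and> card Y = j}" by (rule image_eqI)
  next
    fix X assume "X \<in> insert s ` {Y. Y \<subseteq> V - {s} \<and> card Y = j}"
    then obtain Y where Y: "X = insert s Y" "Y \<subseteq> V - {s}" "card Y = j" by auto
    then have "finite Y" "s \<notin> Y" using fin[of Y] by auto
    then show "X \<in> {X. s \<in> X \<and> X \<subseteq> V \<and> card X = Suc j}" using Y assms by auto
  qed
  moreover have "inj_on (insert s) {Y. Y \<subseteq> V - {s} \<and> card Y = j}"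
    by (auto simp: inj_on_def)
  ultimately show ?thesis
    using assms by (simp add: card_image n_subsets)
qed

text \<open>
  The event is the disjoint union, over all sets \<open>X\<close> with \<open>s \<in> X \<subseteq> V\<close>, of the events that the
  cluster is \<open>X\<close>. By symmetry the probability of such an event depends only on the size of \<open>X\<close>.
\<close>

lemma prob_out_cluster_subset:
  assumes "s \<in> V" "V \<subseteq> {1..n}"
  shows "measure_pmf.prob (random_digraph p n) {D. out_cluster D s \<subseteq> V} =
           (\<Sum>k=1..card V. real ((card V - 1) choose (k - 1)) * d p n k)"
proof -
  let ?F = "{X. s \<in> X \<and> X \<subseteq> V}"
  have fin: "finite V" using assms(2) finite_subset by blast
  have finF: "finite ?F" by (rule finite_subset[of _ "Pow V"]) (use fin in auto)
  have card: "card ` ?F \<subseteq> {1..card V}"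
  proof clarify
    fix X assume X: "s \<in> X" "X \<subseteq> V"
    then have "finite X" using fin finite_subset by blast
    then show "card X \<in> {1..card V}"
      using X card_mono[OF fin X(2)] by (auto simp: Suc_le_eq card_gt_0_iff)
  qed
  have "measure_pmf.prob (random_digraph p n) {D. out_cluster D s \<subseteq> V} =
      measure_pmf.prob (map_pmf (\<lambda>D. out_cluster D s) (random_digraph p n)) ?F"
    by (simp add: vimage_def out_cluster_def)
  also have "\<dots> = (\<Sum>X\<in>?F. pmf (map_pmf (\<lambda>D. out_cluster D s) (random_digraph p n)) X)"
    by (rule measure_measure_pmf_finite[OF finF])
  also have "\<dots> = (\<Sum>X\<in>?F. d p n (card X))"
    using assms(2) by (intro sum.cong refl) (auto simp: pmf_map vimage_def prob_out_cluster_eq_d)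
  also have "\<dots> = (\<Sum>k=1..card V. \<Sum>X\<in>{X \<in> ?F. card X = k}. d p n (card X))"
    by (rule sum.group[OF finF _ card, symmetric]) simp
  also have "\<dots> = (\<Sum>k=1..card V. real ((card V - 1) choose (k - 1)) * d p n k)"
  proof (rule sum.cong[OF refl])
    fix k assume "k \<in> {1..card V}"
    then have "{X \<in> ?F. card X = k} = {X. s \<in> X \<and> X \<subseteq> V \<and> card X = Suc (k - 1)}" by auto
    then have "card {X \<in> ?F. card X = k} = (card V - 1) choose (k - 1)"
      by (simp only: card_subsets_containing[OF fin assms(1)])
    then show "(\<Sum>X\<in>{X \<in> ?F. card X = k}. d p n (card X)) =
        real ((card V - 1) choose (k - 1)) * d p n k" by simp
  qed
  finally show ?thesis .
qed

theorem lemma5p1: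
  fixes p y :: real
  assumes "p \<in> {0..1}" and "y = 1 - p / 2"
  shows "(\<forall>n k. n > k \<and> k \<ge> 1 \<longrightarrow> d p n k = d p k k * y ^ (k * (n - k))) \<and>
    (\<forall>k\<ge>1. d p k k =
       1 - (\<Sum>i=1..k-1. real ((k - 1) choose (i - 1)) * d p i i * y ^ (i * (k - i)))) \<and>
    (\<forall>n\<ge>2. f p n =
       (\<Sum>k=1..n-1. real ((n - 2) choose (k - 1)) * d p k k * y ^ (k * (n - k))))"
proof (intro conjI allI impI)
  fix n k :: nat assume "n > k \<and> k \<ge> 1"
  then show "d p n k = d p k k * y ^ (k * (n - k))"
    unfolding assms(2) by (intro d_eq_d_diag[OF assms(1)]) simp_all
next
  fix k :: nat assume k: "k \<ge> 1"
  have "measure_pmf.prob (random_digraph p k) {D. out_cluster D 1 \<subseteq> {1..k}} = 1"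
    using k out_cluster_random_digraph_subset[of _ p k 1]
    by (simp add: measure_pmf.prob_eq_1 AE_measure_pmf_iff)
  then have "1 = (\<Sum>i=1..k. real ((k - 1) choose (i - 1)) * d p k i)"
    using k by (simp add: prob_out_cluster_subset)
  also have "\<dots> = (\<Sum>i=1..k-1. real ((k - 1) choose (i - 1)) * d p k i) + d p k k"
    using k by (cases k) simp_all
  also have "(\<Sum>i=1..k-1. real ((k - 1) choose (i - 1)) * d p k i) =
      (\<Sum>i=1..k-1. real ((k - 1) choose (i - 1)) * d p i i * y ^ (i * (k - i)))"
    using assms by (intro sum.cong refl) (auto simp: d_eq_d_diag[of p _ k])
  finally show "d p k k =
      1 - (\<Sum>i=1..k-1. real ((k - 1) choose (i - 1)) * d p i i * y ^ (i * (k - i)))" by simp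
next
  fix n :: nat assume n: "n \<ge> 2"
  let ?V = "{1..n} - {2}"
  have V: "card ?V = n - 1" "card ?V - 1 = n - 2" using n by simp_all
  have "f p n = measure_pmf.prob (random_digraph p n) {D. out_cluster D 1 \<subseteq> ?V}"
    unfolding f_def
  proof (rule measure_pmf.finite_measure_eq_AE)
    show "AE D in measure_pmf (random_digraph p n).
        (D \<in> {D. 2 \<notin> out_cluster D 1}) = (D \<in> {D. out_cluster D 1 \<subseteq> ?V})"
      using n out_cluster_random_digraph_subset[of _ p n 1]
      by (auto simp: AE_measure_pmf_iff)
  qed simp_all
  also have "\<dots> = (\<Sum>k=1..n-1. real ((n - 2) choose (k - 1)) * d p n k)"
    using n prob_out_cluster_subset[of 1 ?V n p] V by simp
  also have "\<dots> = (\<Sum>k=1..n-1. real ((n - 2) choose (k - 1)) * d p k k * y ^ (k * (n - k)))"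
    using assms by (intro sum.cong refl) (auto simp: d_eq_d_diag[of p _ n])
  finally show "f p n =
      (\<Sum>k=1..n-1. real ((n - 2) choose (k - 1)) * d p k k * y ^ (k * (n - k)))" .
qed

end
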